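(* Suppose $(\xi_n)_{n\geq0}\subset\mathcal{L}^2(M)$ is a martingale with respect to the filtration $\mathfrak{F}=(\mathcal{F}_n)_{n\geq0}$, where $\mathcal{F}_n=\sigma\{Z_k\mid0\le k\le n\}$. Then $(\xi_n)_{n\geq0}$ is an $M$-generalized martingale.
   Context: $\mathbb{N}$ is the set of nonnegative integers and $\Gamma$ is the set of all finite subsets of $\mathbb{N}$. $(\Omega,\mathcal{F},P)$ is a probability space with expectation $\mathbb{E}$. A discrete-time normal martingale is a real-valued square integrable process $M=(M_n)_{n\in\mathbb{N}}$ on it such that $\mathbb{E}[M_0|\mathcal{F}_{-1}]=0$, $\mathbb{E}[M_n|\mathcal{F}_{n-1}]=M_{n-1}$ for $n\ge1$, $\mathbb{E}[M_0^2|\mathcal{F}_{-1}]=1$ and $\mathbb{E}[M_n^2|\mathcal{F}_{n-1}]=M_{n-1}^2+1$ for $n\ge1$, where $\mathcal{F}_{-1}=\{\emptyset,\Omega\}$ and $\mathcal{F}_n=\sigma(M_k;0\le k\le n)$. Its associated discrete-time normal noise is $Z_0=M_0$, $Z_n=M_n-M_{n-1}$ ($n\ge 1$) (so $\mathcal{F}_n=\sigma\{Z_k\mid 0\le k\le n\}$). Put $Z_\emptyset=1$ and $Z_\sigma=\prod_{i\in\sigma}Z_i$ for nonempty $\sigma\in\Gamma$. Let $\mathcal{F}_\infty=\sigma(M_n;n\in\mathbb{N})$ and let $\mathcal{L}^2(M)=\mathcal{L}^2(\Omega,\mathcal{F}_\infty,P)$ be the complex Hilbert space with inner product $\langle\cdot,\cdot\rangle$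 (conjugate-linear in the first argument, linear in the second) and norm $\|\cdot\|$. $M$ has the chaotic representation property if $\{Z_\sigma\mid\sigma\in\Gamma\}$ is total in $\mathcal{L}^2(M)$. Standing assumption: $M$ is a discrete-time normal martingale with the chaotic representation property; then $\{Z_\sigma\mid\sigma\in\Gamma\}$ is an orthonormal basis of $\mathcal{L}^2(M)$. Let $\lambda_\emptyset=1$ and $\lambda_\sigma=\prod_{k\in\sigma}(k+1)$ for nonempty $\sigma\in\Gamma$. For $p\ge0$ put $\|\xi\|_p^2=\sum_{\sigma\in\Gamma}\lambda_\sigma^{2p}|\langle Z_\sigma,\xi\rangle|^2$ and $\mathcal{S}_p(M)=\{\xi\in\mathcal{L}^2(M)\mid\|\xi\|_p<\infty\}$, a Hilbert space with norm $\|\cdot\|_p$. Let $\mathcal{S}(M)=\bigcap_{p=0}^\infty\mathcal{S}_p(M)$ with the topology generated by the norms $\{\|\cdot\|_p\}_{p\ge0}$; it contains all $Z_\sigma$. $\mathcal{S}^*(M)$ is the topological dual of $\mathcal{S}(M)$; its elements are called generalized functionals of $M$. The canonical bilinear form is $\langle\!\langle\Phi,\xi\rangle\!\rangle=\Phi(\xi)$ for $\Phi\in\mathcal{S}^*(M)$, $\xi\in\mathcal{S}(M)$. By identifying $\mathcal{L}^2(M)$ with its dual one has $\mathcal{S}(M)\subset\mathcal{L}^2(M)\subset\mathcal{S}^*(M)$; under this identification $\langle\!\langle\eta,\xi\rangle\!\rangle=\langle\eta,\xi\rangle$ for $\eta\in\mathcal{L}^2(M)$, $\xi\in\mathcal{S}(M)$.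 The Fock transform of $\Phi\in\mathcal{S}^*(M)$ is the function $\widehat{\Phi}$ on $\Gamma$ given by $\widehat{\Phi}(\sigma)=\langle\!\langle\Phi,Z_\sigma\rangle\!\rangle$. For $n\ge0$, $\Gamma_{n]}$ is the power set of $\{0,1,\dots,n\}$ and $\mathbf{I}_{n]}$ is its indicator function on $\Gamma$. A sequence $(\Phi_n)_{n\ge0}\subset\mathcal{S}^*(M)$ is called an $M$-generalized martingale if $\widehat{\Phi_n}(\sigma)=\mathbf{I}_{n]}(\sigma)\widehat{\Phi_{n+1}}(\sigma)$ for all $\sigma\in\Gamma$ and $n\ge0$. *)

theory Defs
  imports "HOL-Probability.Probability"
begin

definition gen_sigma :: "'a measure \<Rightarrow> (nat \<Rightarrow> 'a \<Rightarrow> real) \<Rightarrow> nat set \<Rightarrow> 'a measure" where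
  "gen_sigma P X I =
     sigma (space P) (\<Union>k\<in>I. {X k -` A \<inter> space P | A. A \<in> sets borel})"

text \<open>The \<open>\<sigma>\<close>-algebra \<open>\<F>\<^sub>n\<close> is \<open>gen_sigma P M {..n}\<close>, the trivial one \<open>\<F>\<^sub>-\<^sub>1\<close> is
  \<open>sigma (space P) {}\<close>. All identities between conditional expectations hold almost surely.\<close>

definition normal_martingale :: "'a measure \<Rightarrow> (nat \<Rightarrow> 'a \<Rightarrow> real) \<Rightarrow> bool" where
  "normal_martingale P M \<longleftrightarrow>
     (\<forall>n. M n \<in> borel_measurable P \<and> integrable P (\<lambda>x. (M n x)\<^sup>2)) \<and>
     (AE x in P. real_cond_exp P (sigma (space P) {}) (M 0) x = 0) \<and>
     (\<forall>n\<ge>1. AE x in P. real_cond_exp P (gen_sigma P M {..n - 1}) (M n) x = M (n - 1) x) \<and>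
     (AE x in P. real_cond_exp P (sigma (space P) {}) (\<lambda>y. (M 0 y)\<^sup>2) x = 1) \<and>
     (\<forall>n\<ge>1. AE x in P.
        real_cond_exp P (gen_sigma P M {..n - 1}) (\<lambda>y. (M n y)\<^sup>2) x = (M (n - 1) x)\<^sup>2 + 1)"

definition noise :: "(nat \<Rightarrow> 'a \<Rightarrow> real) \<Rightarrow> nat \<Rightarrow> 'a \<Rightarrow> real" where
  "noise M n x = (if n = 0 then M 0 x else M n x - M (n - 1) x)"

definition finsets :: "nat set set" where
  "finsets = {\<sigma>. finite \<sigma>}"

definition Z :: "(nat \<Rightarrow> 'a \<Rightarrow> real) \<Rightarrow> nat set \<Rightarrow> 'a \<Rightarrow> complex" where
  "Z M \<sigma> x = complex_of_real (\<Prod>i\<in>\<sigma>. noise M i x)"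

text \<open>Elements of the Hilbert space \<open>L\<^sup>2(M)\<close> are represented by functions; two functions that
  agree almost surely represent the same element.\<close>

definition L2 :: "'a measure \<Rightarrow> (nat \<Rightarrow> 'a \<Rightarrow> real) \<Rightarrow> ('a \<Rightarrow> complex) set" where
  "L2 P M = {f \<in> borel_measurable (gen_sigma P M UNIV). integrable P (\<lambda>x. (cmod (f x))\<^sup>2)}"

definition L2_inner :: "'a measure \<Rightarrow> ('a \<Rightarrow> complex) \<Rightarrow> ('a \<Rightarrow> complex) \<Rightarrow> complex" where
  "L2_inner P f g = (\<integral>x. cnj (f x) * g x \<partial>P)"

definition L2_norm :: "'a measure \<Rightarrow> ('a \<Rightarrow> complex) \<Rightarrow> real" where
  "L2_norm P f = sqrt (Re (L2_inner P f f))"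

definition chaotic_representation :: "'a measure \<Rightarrow> (nat \<Rightarrow> 'a \<Rightarrow> real) \<Rightarrow> bool" where
  "chaotic_representation P M \<longleftrightarrow>
     (\<forall>\<xi>\<in>L2 P M. \<forall>e>0. \<exists>A c. finite A \<and> A \<subseteq> finsets \<and>
        L2_norm P (\<lambda>x. \<xi> x - (\<Sum>\<sigma>\<in>A. c \<sigma> * Z M \<sigma> x)) < e)"

definition weight :: "nat set \<Rightarrow> real" where
  "weight \<sigma> = (\<Prod>k\<in>\<sigma>. real k + 1)"

definition S_summand ::
    "'a measure \<Rightarrow> (nat \<Rightarrow> 'a \<Rightarrow> real) \<Rightarrow> nat \<Rightarrow> ('a \<Rightarrow> complex) \<Rightarrow> nat set \<Rightarrow> real" where
  "S_summand P M p \<xi> \<sigma> = weight \<sigma> ^ (2 * p) * (cmod (L2_inner P (Z M \<sigma>) \<xi>))\<^sup>2"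

definition S_norm :: "'a measure \<Rightarrow> (nat \<Rightarrow> 'a \<Rightarrow> real) \<Rightarrow> nat \<Rightarrow> ('a \<Rightarrow> complex) \<Rightarrow> real" where
  "S_norm P M p \<xi> = sqrt (\<Sum>\<^sub>\<infinity>\<sigma>\<in>finsets. S_summand P M p \<xi> \<sigma>)"

definition S_level :: "'a measure \<Rightarrow> (nat \<Rightarrow> 'a \<Rightarrow> real) \<Rightarrow> nat \<Rightarrow> ('a \<Rightarrow> complex) set" where
  "S_level P M p = {\<xi> \<in> L2 P M. S_summand P M p \<xi> summable_on finsets}"

definition S_space :: "'a measure \<Rightarrow> (nat \<Rightarrow> 'a \<Rightarrow> real) \<Rightarrow> ('a \<Rightarrow> complex) set" where
  "S_space P M = (\<Inter>p. S_level P M p)"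

definition S_topology :: "'a measure \<Rightarrow> (nat \<Rightarrow> 'a \<Rightarrow> real) \<Rightarrow> ('a \<Rightarrow> complex) topology" where
  "S_topology P M = topology_generated_by
     {{\<eta> \<in> S_space P M. S_norm P M p (\<lambda>x. \<eta> x - \<xi> x) < r} | p \<xi> r. \<xi> \<in> S_space P M \<and> r > 0}"

text \<open>Functions that agree almost surely cannot be separated by the topology above, so a continuous
  functional is automatically well defined on equivalence classes.\<close>

definition S_dual ::
    "'a measure \<Rightarrow> (nat \<Rightarrow> 'a \<Rightarrow> real) \<Rightarrow> (('a \<Rightarrow> complex) \<Rightarrow> complex) set" where
  "S_dual P M = {\<Phi> \<in> extensional (S_space P M).
     (\<forall>\<xi>\<in>S_space P M. \<forall>\<eta>\<in>S_space P M. \<forall>a b.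
        \<Phi> (\<lambda>x. a * \<xi> x + b * \<eta> x) = a * \<Phi> \<xi> + b * \<Phi> \<eta>) \<and>
     continuous_map (S_topology P M) euclidean \<Phi>}"

text \<open>The (conjugate-linear) inclusion of \<open>L\<^sup>2(M)\<close> into the dual.\<close>

definition L2_embed ::
    "'a measure \<Rightarrow> (nat \<Rightarrow> 'a \<Rightarrow> real) \<Rightarrow> ('a \<Rightarrow> complex) \<Rightarrow> ('a \<Rightarrow> complex) \<Rightarrow> complex" where
  "L2_embed P M \<eta> = (\<lambda>\<xi>\<in>S_space P M. L2_inner P \<eta> \<xi>)"

definition fock ::
    "(nat \<Rightarrow> 'a \<Rightarrow> real) \<Rightarrow> (('a \<Rightarrow> complex) \<Rightarrow> complex) \<Rightarrow> nat set \<Rightarrow> complex" where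
  "fock M \<Phi> \<sigma> = \<Phi> (Z M \<sigma>)"

definition generalized_martingale ::
    "'a measure \<Rightarrow> (nat \<Rightarrow> 'a \<Rightarrow> real) \<Rightarrow> (nat \<Rightarrow> ('a \<Rightarrow> complex) \<Rightarrow> complex) \<Rightarrow> bool" where
  "generalized_martingale P M \<Phi> \<longleftrightarrow>
     (\<forall>n. \<Phi> n \<in> S_dual P M) \<and>
     (\<forall>n. \<forall>\<sigma>\<in>finsets. fock M (\<Phi> n) \<sigma> = indicator (Pow {0..n}) \<sigma> * fock M (\<Phi> (Suc n)) \<sigma>)"

definition complex_cond_exp ::
    "'a measure \<Rightarrow> 'a measure \<Rightarrow> ('a \<Rightarrow> complex) \<Rightarrow> 'a \<Rightarrow> complex" where
  "complex_cond_exp P F f x =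
     Complex (real_cond_exp P F (\<lambda>y. Re (f y)) x) (real_cond_exp P F (\<lambda>y. Im (f y)) x)"

text \<open>Since members of \<open>L\<^sup>2(M)\<close> are classes modulo null sets, adaptedness only asks for an
  \<open>F n\<close>-measurable version.\<close>

definition martingale ::
    "'a measure \<Rightarrow> (nat \<Rightarrow> 'a measure) \<Rightarrow> (nat \<Rightarrow> 'a \<Rightarrow> complex) \<Rightarrow> bool" where
  "martingale P F \<xi> \<longleftrightarrow>
     (\<forall>n. integrable P (\<xi> n)) \<and>
     (\<forall>n. \<exists>g\<in>borel_measurable (F n). AE x in P. \<xi> n x = g x) \<and>
     (\<forall>n. AE x in P. complex_cond_exp P (F n) (\<xi> (Suc n)) x = \<xi> n x)"

end

theory Submission imports Defs begin

text \<open>Conditioning on the past of the largest index gives orthonormality of the \<open>Z \<sigma>\<close>, and with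
  it the chaotic representation property gives \<open>\<parallel>\<xi>\<parallel> \<le> \<parallel>\<xi>\<parallel>\<^sub>0\<close>; hence \<open>L\<^sup>2(M)\<close> embeds into the dual.
  For \<open>\<sigma> \<subseteq> {0..n}\<close> the functional \<open>Z \<sigma>\<close> is \<open>\<F>\<^sub>n\<close>-measurable, so the martingale property yields
  \<open>\<langle>\<xi>\<^sub>n, Z \<sigma>\<rangle> = \<langle>\<xi>\<^sub>n\<^sub>+\<^sub>1, Z \<sigma>\<rangle>\<close>. Otherwise \<open>m = Max \<sigma>\<close> exceeds \<open>n\<close>, and \<open>\<langle>\<xi>\<^sub>n, Z \<sigma>\<rangle> = 0\<close> because the
  \<open>m\<close>-th noise has conditional mean zero given \<open>\<F>\<^sub>m\<^sub>-\<^sub>1\<close>.\<close>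

section \<open>Generated sigma-algebras and conditional expectations\<close>

lemma space_gen_sigma [simp]: "space (gen_sigma P X I) = space P"
  unfolding gen_sigma_def by (rule space_measure_of) auto

lemma measurable_gen_sigma:
  assumes "k \<in> I"
  shows "X k \<in> borel_measurable (gen_sigma P X I)"
proof (rule measurableI)
  fix A :: "real set" assume "A \<in> sets borel"
  then show "X k -` A \<inter> space (gen_sigma P X I) \<in> sets (gen_sigma P X I)"
    using assms unfolding space_gen_sigma unfolding gen_sigma_def by (intro in_measure_of) blast+
qed simp

lemma sets_gen_sigma_le:
  assumes "space N = space P" and "\<And>k. k \<in> I \<Longrightarrow> X k \<in> borel_measurable N"
  shows "sets (gen_sigma P X I) \<subseteq> sets N"
proof -
  let ?G = "\<Union>k\<in>I. {X k -` A \<inter> space P |A. A \<in> sets borel}"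
  have "sets (gen_sigma P X I) = sigma_sets (space P) ?G"
    unfolding gen_sigma_def by (rule sets_measure_of) auto
  also have "\<dots> \<subseteq> sets N"
    using measurable_sets[OF assms(2)]
    by (intro sets.sigma_sets_subset') (auto simp flip: assms(1))
  finally show ?thesis .
qed

text \<open>Serves to pass from a generated sigma-algebra to \<open>P\<close> and also, with the
  noise as \<open>X\<close>, from the filtration generated by the noise to the one generated by
  \<open>M\<close>.\<close>

lemma borel_measurable_gen_sigma_mono:
  assumes "f \<in> borel_measurable (gen_sigma P X I)" "space N = space P"
    and "\<And>k. k \<in> I \<Longrightarrow> X k \<in> borel_measurable N"
  shows "f \<in> borel_measurable N"
  using assms sets_gen_sigma_le[OF assms(2,3)] unfolding measurable_def by fastforce

lemma (in prob_space) finite_measure_subalgebra_gen_sigma: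
  assumes "\<And>k. k \<in> I \<Longrightarrow> X k \<in> borel_measurable M"
  shows "finite_measure_subalgebra M (gen_sigma M X I)"
  using sets_gen_sigma_le[of M M I X] assms
  by unfold_locales (auto simp: subalgebra_def)

text \<open>The hypotheses on \<open>M\<close> speak of \<open>real_cond_exp\<close>, whose pull-out
  rule asks for an integrable product. This bridge to \<open>nn_cond_exp\<close> allows computing in
  \<open>ennreal\<close> before integrability is known.\<close>

lemma (in sigma_finite_subalgebra) nn_cond_exp_eq_real_cond_exp:
  assumes int: "integrable M f" and nonneg: "\<And>x. f x \<ge> 0"
  shows "AE x in M. ennreal (real_cond_exp M F f x) = nn_cond_exp M F (\<lambda>x. ennreal (f x)) x"
proof (rule nn_cond_exp_charact)
  note [measurable] = borel_measurable_integrable[OF int]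
  have pos: "AE x in M. 0 \<le> real_cond_exp M F f x"
    by (rule real_cond_exp_pos) (auto simp: nonneg)
  fix A assume A: "A \<in> sets F"
  then have [measurable]: "A \<in> sets M"
    using subalg by (auto simp: subalgebra_def)
  have "(\<integral>\<^sup>+x\<in>A. ennreal (f x) \<partial>M) = (\<integral>\<^sup>+x. ennreal (indicator A x * f x) \<partial>M)"
    by (intro nn_integral_cong) (auto simp: indicator_def)
  also have "\<dots> = ennreal (\<integral>x. indicator A x * f x \<partial>M)"
    using integrable_mult_indicator[OF _ int, of A]
    by (intro nn_integral_eq_integral) (auto simp: nonneg)
  also have "(\<integral>x. indicator A x * f x \<partial>M) = (\<integral>x. indicator A x * real_cond_exp M F f x \<partial>M)"
    using real_cond_exp_intA[OF int A] by (simp add: set_lebesgue_integral_def)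
  also have "ennreal \<dots> = (\<integral>\<^sup>+x. ennreal (indicator A x * real_cond_exp M F f x) \<partial>M)"
    using integrable_mult_indicator[OF _ real_cond_exp_int(1)[OF int], of A] pos
    by (intro nn_integral_eq_integral[symmetric]) auto
  also have "\<dots> = (\<integral>\<^sup>+x\<in>A. ennreal (real_cond_exp M F f x) \<partial>M)"
    by (intro nn_integral_cong) (auto simp: indicator_def)
  finally show "(\<integral>\<^sup>+x\<in>A. ennreal (f x) \<partial>M) = (\<integral>\<^sup>+x\<in>A. ennreal (real_cond_exp M F f x) \<partial>M)" .
qed (use int in auto)

section \<open>Conjugation and elementary inequalities\<close>

lemma borel_measurable_cnj_comp:
  "f \<in> borel_measurable N \<Longrightarrow> (\<lambda>x. cnj (f x)) \<in> borel_measurable N"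
  by (rule borel_measurable_continuous_on[where f = cnj]) (auto intro: continuous_intros)

text \<open>A crude form of the arithmetic-geometric mean inequality, enough to dominate a product
  of two square integrable functions by an integrable one.\<close>

lemma abs_mult_le_sum_squares: "\<bar>a * b\<bar> \<le> a\<^sup>2 + b\<^sup>2" for a b :: real
proof -
  have "2 * (\<bar>a\<bar> * \<bar>b\<bar>) \<le> a\<^sup>2 + b\<^sup>2"
    using sum_squares_bound[of "\<bar>a\<bar>" "\<bar>b\<bar>"] by (simp add: mult.assoc)
  moreover have "0 \<le> \<bar>a\<bar> * \<bar>b\<bar>" by simp
  ultimately show ?thesis unfolding abs_mult by linarith
qed

text \<open>The factor 2 absorbs the cross term, so that square integrability and weighted
  summability pass to linear combinations by comparison.\<close>

lemma cmod_lincomb_sq_le: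
  "(cmod (a * u + b * v))\<^sup>2 \<le> 2 * (cmod a)\<^sup>2 * (cmod u)\<^sup>2 + 2 * (cmod b)\<^sup>2 * (cmod v)\<^sup>2"
proof -
  have "(s + t)\<^sup>2 \<le> 2 * s\<^sup>2 + 2 * t\<^sup>2" for s t :: real
    using sum_squares_bound[of s t] by (simp add: power2_sum)
  then have "(cmod (a * u) + cmod (b * v))\<^sup>2 \<le> 2 * (cmod (a * u))\<^sup>2 + 2 * (cmod (b * v))\<^sup>2" .
  moreover have "(cmod (a * u + b * v))\<^sup>2 \<le> (cmod (a * u) + cmod (b * v))\<^sup>2"
    by (intro power_mono norm_triangle_ineq) simp
  ultimately show ?thesis unfolding norm_mult power_mult_distrib mult.assoc by (rule order_trans[rotated])
qed

section \<open>Conditional moments of the noise\<close>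

locale normal_martingale_space = prob_space P for P :: "'a measure" +
  fixes M :: "nat \<Rightarrow> 'a \<Rightarrow> real"
  assumes normal: "normal_martingale P M"
begin

text \<open>The index is shifted by one: \<open>past (Suc k)\<close> is the sigma-algebra of M_0,
  ..., M_k, and \<open>past 0\<close>, generated by an empty family, is the trivial one. Thus time 0
  needs no separate treatment once the conditional moments are known.\<close>

abbreviation past :: "nat \<Rightarrow> 'a measure" where
  "past m \<equiv> gen_sigma P M {..<m}"

lemma M_meas [measurable]: "M n \<in> borel_measurable P"
  and M_sq: "integrable P (\<lambda>x. (M n x)\<^sup>2)"
  using normal unfolding normal_martingale_def by blast+

lemma noise_meas [measurable]: "noise M n \<in> borel_measurable P"
  unfolding noise_def[abs_def] by (cases "n = 0") simp_all

lemma noise_meas_gen_sigma: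
  assumes "{..k} \<subseteq> I"
  shows "noise M k \<in> borel_measurable (gen_sigma P M I)"
proof -
  have "M k \<in> borel_measurable (gen_sigma P M I)" "M (k - 1) \<in> borel_measurable (gen_sigma P M I)"
    by (rule measurable_gen_sigma; use assms in auto)+
  then show ?thesis unfolding noise_def[abs_def] by (cases "k = 0") simp_all
qed

lemma finite_subalg: "finite_measure_subalgebra P (gen_sigma P M I)"
  by (rule finite_measure_subalgebra_gen_sigma) simp

lemma M_int: "integrable P (M n)"
  using square_integrable_imp_integrable[OF M_meas M_sq] .

lemma M_prod_int: "integrable P (\<lambda>x. M m x * M n x)"
  by (rule Bochner_Integration.integrable_bound[OF Bochner_Integration.integrable_add[OF M_sq[of m] M_sq[of n]]]) (auto simp: abs_mult_le_sum_squares)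

lemma noise_int: "integrable P (noise M n)"
  unfolding noise_def[abs_def] by (cases "n = 0") (simp_all add: M_int)

lemma noise_sq_int: "integrable P (\<lambda>x. (noise M n x)\<^sup>2)"
  unfolding noise_def by (cases "n = 0") (simp_all add: M_sq M_prod_int power2_diff mult.assoc)

lemma cond_exp_M_Suc: "AE x in P. real_cond_exp P (past (Suc k)) (M (Suc k)) x = M k x"
proof -
  have "\<forall>n\<ge>1. AE x in P. real_cond_exp P (gen_sigma P M {..n - 1}) (M n) x = M (n - 1) x"
    using normal unfolding normal_martingale_def by blast
  from this[rule_format, of "Suc k"] show ?thesis by (simp add: lessThan_Suc_atMost)
qed

lemma cond_exp_M_Suc_sq:
  "AE x in P. real_cond_exp P (past (Suc k)) (\<lambda>y. (M (Suc k) y)\<^sup>2) x = (M k x)\<^sup>2 + 1"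
proof -
  have "\<forall>n\<ge>1. AE x in P.
      real_cond_exp P (gen_sigma P M {..n - 1}) (\<lambda>y. (M n y)\<^sup>2) x = (M (n - 1) x)\<^sup>2 + 1"
    using normal unfolding normal_martingale_def by blast
  from this[rule_format, of "Suc k"] show ?thesis by (simp add: lessThan_Suc_atMost)
qed

lemma cond_exp_noise: "AE x in P. real_cond_exp P (past m) (noise M m) x = 0"
proof (cases m)
  case 0
  have "AE x in P. real_cond_exp P (sigma (space P) {}) (M 0) x = 0"
    using normal unfolding normal_martingale_def by blast
  with 0 show ?thesis by (simp add: gen_sigma_def noise_def[abs_def])
next
  case (Suc k)
  interpret F: finite_measure_subalgebra P "past m" by (rule finite_subalg)
  have "AE x in P. real_cond_exp P (past m) (M m) x = M k x"
    unfolding Suc by (rule cond_exp_M_Suc)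
  moreover have "AE x in P. real_cond_exp P (past m) (M k) x = M k x"
    by (rule F.real_cond_exp_F_meas) (use Suc in \<open>auto intro: M_int measurable_gen_sigma\<close>)
  moreover have "AE x in P. real_cond_exp P (past m) (\<lambda>x. M m x - M k x) x
      = real_cond_exp P (past m) (M m) x - real_cond_exp P (past m) (M k) x"
    by (rule F.real_cond_exp_diff) (auto intro: M_int)
  ultimately show ?thesis using Suc by (auto simp: noise_def[abs_def])
qed

text \<open>For m = k + 1, expand the square and pull the \<open>past m\<close>-measurable factor 2
  M_k out of the cross term: (M_k^2 + 1) + M_k^2 - 2 M_k * M_k = 1.\<close>

lemma cond_exp_noise_sq: "AE x in P. real_cond_exp P (past m) (\<lambda>y. (noise M m y)\<^sup>2) x = 1"
proof (cases m)
  case 0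
  have "AE x in P. real_cond_exp P (sigma (space P) {}) (\<lambda>y. (M 0 y)\<^sup>2) x = 1"
    using normal unfolding normal_martingale_def by blast
  with 0 show ?thesis by (simp add: gen_sigma_def noise_def[abs_def])
next
  case (Suc k)
  interpret F: finite_measure_subalgebra P "past m" by (rule finite_subalg)
  have [measurable]: "M k \<in> borel_measurable (past m)"
    using Suc by (auto intro: measurable_gen_sigma)
  have "AE x in P. real_cond_exp P (past m) (M m) x = M k x"
    unfolding Suc by (rule cond_exp_M_Suc)
  moreover have "AE x in P. real_cond_exp P (past m) (\<lambda>y. (M m y)\<^sup>2) x = (M k x)\<^sup>2 + 1"
    unfolding Suc by (rule cond_exp_M_Suc_sq)
  moreover have "AE x in P. real_cond_exp P (past m) (\<lambda>y. (M k y)\<^sup>2) x = (M k x)\<^sup>2"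
    by (rule F.real_cond_exp_F_meas) (auto intro: M_sq)
  moreover have "AE x in P. real_cond_exp P (past m) (\<lambda>y. (2 * M k y) * M m y) x
      = (2 * M k x) * real_cond_exp P (past m) (M m) x"
    by (rule F.real_cond_exp_mult) (auto simp: mult.assoc intro: M_prod_int)
  moreover have "AE x in P. real_cond_exp P (past m) (\<lambda>y. ((M m y)\<^sup>2 + (M k y)\<^sup>2) - (2 * M k y) * M m y) x
      = real_cond_exp P (past m) (\<lambda>y. (M m y)\<^sup>2 + (M k y)\<^sup>2) x
        - real_cond_exp P (past m) (\<lambda>y. (2 * M k y) * M m y) x"
    by (rule F.real_cond_exp_diff) (auto simp: mult.assoc intro: M_sq M_prod_int)
  moreover have "AE x in P. real_cond_exp P (past m) (\<lambda>y. (M m y)\<^sup>2 + (M k y)\<^sup>2) x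
      = real_cond_exp P (past m) (\<lambda>y. (M m y)\<^sup>2) x + real_cond_exp P (past m) (\<lambda>y. (M k y)\<^sup>2) x"
    by (rule F.real_cond_exp_add) (auto intro: M_sq)
  moreover have "(\<lambda>y. (noise M m y)\<^sup>2) = (\<lambda>y. ((M m y)\<^sup>2 + (M k y)\<^sup>2) - (2 * M k y) * M m y)"
    using Suc by (simp add: noise_def[abs_def] power2_diff mult_ac)
  ultimately show ?thesis by (auto simp: power2_eq_square)
qed

text \<open>Pulling \<open>X\<close> out of the conditional expectation given \<open>past m\<close>
  leaves the conditional mean of the noise, which is 0.\<close>

lemma noise_orthogonal_past:
  assumes X: "X \<in> borel_measurable (past m)" and int: "integrable P (\<lambda>x. X x * noise M m x)"
  shows "(\<integral>x. X x * noise M m x \<partial>P) = 0"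
proof -
  interpret F: finite_measure_subalgebra P "past m" by (rule finite_subalg)
  have "(\<integral>x. X x * noise M m x \<partial>P) = (\<integral>x. X x * real_cond_exp P (past m) (noise M m) x \<partial>P)"
    by (rule F.real_cond_exp_intg(2)[symmetric, OF int X]) simp
  also have "\<dots> = 0"
    using cond_exp_noise[of m] by (intro integral_eq_zero_AE) auto
  finally show ?thesis .
qed

lemma noise_orthogonal_past_complex:
  fixes X :: "'a \<Rightarrow> complex"
  assumes [measurable]: "X \<in> borel_measurable (past m)"
    and int: "integrable P (\<lambda>x. X x * complex_of_real (noise M m x))"
  shows "(\<integral>x. X x * complex_of_real (noise M m x) \<partial>P) = 0"
proof (rule complex_eqI)
  have "(\<integral>x. Re (X x) * noise M m x \<partial>P) = 0"
    using integrable_Re[OF int] by (intro noise_orthogonal_past) auto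
  then show "Re (\<integral>x. X x * complex_of_real (noise M m x) \<partial>P) = Re 0"
    using integral_Re[OF int] by simp
  have "(\<integral>x. Im (X x) * noise M m x \<partial>P) = 0"
    using integrable_Im[OF int] by (intro noise_orthogonal_past) auto
  then show "Im (\<integral>x. X x * complex_of_real (noise M m x) \<partial>P) = Im 0"
    using integral_Im[OF int] by simp
qed

lemma integral_times_noise_sq:
  assumes X: "X \<in> borel_measurable (past m)" and int: "integrable P (\<lambda>x. X x * (noise M m x)\<^sup>2)"
  shows "(\<integral>x. X x * (noise M m x)\<^sup>2 \<partial>P) = (\<integral>x. X x \<partial>P)"
proof -
  interpret F: finite_measure_subalgebra P "past m" by (rule finite_subalg)
  have [measurable]: "X \<in> borel_measurable P"
    by (rule measurable_from_subalg[OF F.subalg X])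
  have "(\<integral>x. X x * (noise M m x)\<^sup>2 \<partial>P) = (\<integral>x. X x * real_cond_exp P (past m) (\<lambda>y. (noise M m y)\<^sup>2) x \<partial>P)"
    by (rule F.real_cond_exp_intg(2)[symmetric, OF int X]) simp
  also have "\<dots> = (\<integral>x. X x \<partial>P)"
    using cond_exp_noise_sq[of m] measurable_from_subalg[OF F.subalg borel_measurable_cond_exp]
    by (intro integral_cong_AE) auto
  finally show ?thesis .
qed

text \<open>In \<open>ennreal\<close> the pull-out rule asks for measurability only. It replaces the
  squared noise by its conditional mean 1, so the integral of the product equals that of
  \<open>X\<close> and is finite.\<close>

lemma integrable_times_noise_sq:
  assumes X: "X \<in> borel_measurable (past m)" and nonneg: "\<And>x. X x \<ge> 0" and int: "integrable P X"
  shows "integrable P (\<lambda>x. X x * (noise M m x)\<^sup>2)"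
proof -
  interpret F: finite_measure_subalgebra P "past m" by (rule finite_subalg)
  have [measurable]: "X \<in> borel_measurable P"
    by (rule measurable_from_subalg[OF F.subalg X])
  have one: "AE x in P. nn_cond_exp P (past m) (\<lambda>y. ennreal ((noise M m y)\<^sup>2)) x = 1"
    using cond_exp_noise_sq[of m] F.nn_cond_exp_eq_real_cond_exp[OF noise_sq_int[of m]] by auto
  have "(\<integral>\<^sup>+x. ennreal (X x * (noise M m x)\<^sup>2) \<partial>P) = (\<integral>\<^sup>+x. ennreal (X x) * ennreal ((noise M m x)\<^sup>2) \<partial>P)"
    by (simp add: ennreal_mult nonneg)
  also have "\<dots> = (\<integral>\<^sup>+x. ennreal (X x) * nn_cond_exp P (past m) (\<lambda>y. ennreal ((noise M m y)\<^sup>2)) x \<partial>P)"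
    using X by (intro F.nn_cond_exp_intg[symmetric]) auto
  also have "\<dots> = (\<integral>\<^sup>+x. ennreal (X x) \<partial>P)"
    using one by (intro nn_integral_cong_AE) auto
  also have "\<dots> < \<infinity>"
    using int by (simp add: nonneg nn_integral_eq_integral)
  finally show ?thesis
    by (intro integrableI_nonneg) (auto simp: nonneg)
qed

section \<open>Orthonormality of the noise products\<close>

lemma prod_noise_meas:
  assumes "\<sigma> \<subseteq> {..<m}"
  shows "(\<lambda>x. \<Prod>i\<in>\<sigma>. noise M i x) \<in> borel_measurable (past m)"
  using assms by (intro borel_measurable_prod noise_meas_gen_sigma) auto

text \<open>The noises need not be independent, so the factors are integrated out one at a time,
  largest index first: the other factors are then measurable with respect to its past.\<close>

lemma prod_noise_sq_int:
  "\<sigma> \<subseteq> {..<m} \<Longrightarrow> integrable P (\<lambda>x. (\<Prod>i\<in>\<sigma>. noise M i x)\<^sup>2)"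
proof (induction m arbitrary: \<sigma>)
  case (Suc m)
  show ?case
  proof (cases "m \<in> \<sigma>")
    case True
    have sub: "\<sigma> - {m} \<subseteq> {..<m}" using Suc.prems by (auto simp: less_Suc_eq)
    have "finite \<sigma>" using Suc.prems finite_subset by blast
    then have "(\<Prod>i\<in>\<sigma>. noise M i x) = (\<Prod>i\<in>\<sigma> - {m}. noise M i x) * noise M m x" for x
      using True by (simp add: prod.remove[of \<sigma> m] mult.commute)
    then show ?thesis
      using integrable_times_noise_sq[of "\<lambda>x. (\<Prod>i\<in>\<sigma> - {m}. noise M i x)\<^sup>2" m] Suc.IH[OF sub]
        prod_noise_meas[OF sub] by (simp add: power_mult_distrib)
  next
    case False
    then show ?thesis using Suc by (metis lessThan_Suc subset_insert)
  qed
qed simp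

lemma prod_noise_prod_int:
  assumes "\<sigma> \<subseteq> {..<m}" "\<tau> \<subseteq> {..<m}"
  shows "integrable P (\<lambda>x. (\<Prod>i\<in>\<sigma>. noise M i x) * (\<Prod>i\<in>\<tau>. noise M i x))"
proof -
  show ?thesis
    by (intro Bochner_Integration.integrable_bound[OF Bochner_Integration.integrable_add[OF
        prod_noise_sq_int[OF assms(1)] prod_noise_sq_int[OF assms(2)]]]) (use assms in \<open>auto simp: abs_mult_le_sum_squares intro!: borel_measurable_times borel_measurable_prod\<close>)
qed

text \<open>Induction on a common bound, by the occurrences of the top index \<open>m\<close>. If it
  lies in both sets, its squared noise integrates to 1 and both sets lose \<open>m\<close>; if in
  exactly one, its noise integrates to 0; if in neither, the induction hypothesis applies
  directly.\<close>

lemma prod_noise_orthonormal: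
  "\<sigma> \<subseteq> {..<m} \<Longrightarrow> \<tau> \<subseteq> {..<m} \<Longrightarrow>
    (\<integral>x. (\<Prod>i\<in>\<sigma>. noise M i x) * (\<Prod>i\<in>\<tau>. noise M i x) \<partial>P) = of_bool (\<sigma> = \<tau>)"
proof (induction m arbitrary: \<sigma> \<tau>)
  case 0
  then show ?case by (simp add: prob_space)
next
  case (Suc m)
  define z where "z \<sigma> x = (\<Prod>i\<in>\<sigma>. noise M i x)" for \<sigma> x
  have z_int: "integrable P (\<lambda>x. z \<sigma> x * z \<tau> x)" if "\<sigma> \<subseteq> {..<Suc m}" "\<tau> \<subseteq> {..<Suc m}" for \<sigma> \<tau>
    unfolding z_def using that by (rule prod_noise_prod_int)
  have z_meas [measurable]: "z \<sigma> \<in> borel_measurable (past m)" if "\<sigma> \<subseteq> {..<m}" for \<sigma>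
    unfolding z_def using that by (rule prod_noise_meas)
  have z_top: "z \<sigma> x = z (\<sigma> - {m}) x * noise M m x" if "\<sigma> \<subseteq> {..<Suc m}" "m \<in> \<sigma>" for \<sigma> x
    unfolding z_def using that finite_subset[OF that(1)] by (simp add: prod.remove[of \<sigma> m] mult.commute)
  \<comment> \<open>The noise at \<open>m\<close> occurs once here, and every other factor belongs
    to \<open>past m\<close>.\<close>
  have one: "(\<integral>x. z \<sigma> x * z \<tau> x \<partial>P) = 0"
    if \<sigma>: "\<sigma> \<subseteq> {..<Suc m}" "m \<in> \<sigma>" and \<tau>: "\<tau> \<subseteq> {..<m}" for \<sigma> \<tau>
  proof -
    have sub: "\<sigma> - {m} \<subseteq> {..<m}" using \<sigma> by (auto simp: less_Suc_eq)
    have eq: "z \<sigma> x * z \<tau> x = (z (\<sigma> - {m}) x * z \<tau> x) * noise M m x" for x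
      using z_top[OF \<sigma>] by simp
    have "\<tau> \<subseteq> {..<Suc m}" using \<tau> by auto
    then show ?thesis using z_int[OF \<sigma>(1), of \<tau>] sub \<tau> unfolding eq
      by (intro noise_orthogonal_past) auto
  qed
  have low: "\<sigma> \<subseteq> {..<m}" if "\<sigma> \<subseteq> {..<Suc m}" "m \<notin> \<sigma>" for \<sigma>
    using that by (auto simp: less_Suc_eq)
  consider (both) "m \<in> \<sigma>" "m \<in> \<tau>" | (left) "m \<in> \<sigma>" "m \<notin> \<tau>"
    | (right) "m \<notin> \<sigma>" "m \<in> \<tau>" | (none) "m \<notin> \<sigma>" "m \<notin> \<tau>" by blast
  then have "(\<integral>x. z \<sigma> x * z \<tau> x \<partial>P) = of_bool (\<sigma> = \<tau>)"
  proof cases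
    case both
    have sub: "\<sigma> - {m} \<subseteq> {..<m}" "\<tau> - {m} \<subseteq> {..<m}" using Suc.prems by (auto simp: less_Suc_eq)
    have eq: "z \<sigma> x * z \<tau> x = (z (\<sigma> - {m}) x * z (\<tau> - {m}) x) * (noise M m x)\<^sup>2" for x
      using z_top[OF Suc.prems(1) both(1)] z_top[OF Suc.prems(2) both(2)]
      by (simp add: power2_eq_square)
    have "(\<integral>x. z \<sigma> x * z \<tau> x \<partial>P) = (\<integral>x. z (\<sigma> - {m}) x * z (\<tau> - {m}) x \<partial>P)"
      using z_int[OF Suc.prems] sub unfolding eq by (intro integral_times_noise_sq) auto
    also have "\<dots> = of_bool (\<sigma> - {m} = \<tau> - {m})"
      unfolding z_def by (rule Suc.IH[OF sub])
    also have "(\<sigma> - {m} = \<tau> - {m}) = (\<sigma> = \<tau>)" using both by blast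
    finally show ?thesis .
  next
    case left
    then show ?thesis using one[OF Suc.prems(1), of \<tau>] low[OF Suc.prems(2)] by auto
  next
    case right
    then show ?thesis using one[OF Suc.prems(2), of \<sigma>] low[OF Suc.prems(1)]
      by (auto simp: mult.commute)
  next
    case none
    then show ?thesis unfolding z_def using Suc low by auto
  qed
  then show ?case by (simp add: z_def)
qed

lemma finsets_bounded: "\<sigma> \<in> finsets \<Longrightarrow> \<exists>m. \<sigma> \<subseteq> {..<m}"
  unfolding finsets_def using finite_nat_iff_bounded by auto

lemma Z_orthonormal:
  assumes "\<sigma> \<in> finsets" "\<tau> \<in> finsets"
  shows "L2_inner P (Z M \<sigma>) (Z M \<tau>) = of_bool (\<sigma> = \<tau>)"
proof -
  obtain m where "\<sigma> \<union> \<tau> \<subseteq> {..<m}"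
    using assms finsets_bounded[of "\<sigma> \<union> \<tau>"] by (auto simp: finsets_def)
  then have "(\<integral>x. complex_of_real ((\<Prod>i\<in>\<sigma>. noise M i x) * (\<Prod>i\<in>\<tau>. noise M i x)) \<partial>P)
      = complex_of_real (of_bool (\<sigma> = \<tau>))"
    by (subst integral_complex_of_real) (simp add: prod_noise_orthonormal[of \<sigma> m \<tau>])
  then show ?thesis unfolding L2_inner_def Z_def by simp
qed

section \<open>The inner product space L2(M) and finite chaos approximations\<close>

lemma L2_meas: "f \<in> L2 P M \<Longrightarrow> f \<in> borel_measurable P"
  unfolding L2_def by (auto intro: borel_measurable_gen_sigma_mono)

lemma L2_sq_int: "f \<in> L2 P M \<Longrightarrow> integrable P (\<lambda>x. (cmod (f x))\<^sup>2)"
  by (simp add: L2_def)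

lemma Z_L2:
  assumes "\<sigma> \<in> finsets"
  shows "Z M \<sigma> \<in> L2 P M"
proof -
  obtain m where "\<sigma> \<subseteq> {..<m}" using finsets_bounded[OF assms] ..
  moreover have "noise M i \<in> borel_measurable (gen_sigma P M UNIV)" for i
    by (rule noise_meas_gen_sigma) simp
  ultimately show ?thesis
    using prod_noise_sq_int[of \<sigma> m]
    by (auto simp: L2_def Z_def[abs_def] norm_mult simp del: of_real_prod)
qed

lemma L2_inner_integrable:
  assumes "f \<in> L2 P M" "g \<in> L2 P M"
  shows "integrable P (\<lambda>x. cnj (f x) * g x)"
proof (rule Bochner_Integration.integrable_bound)
  show "integrable P (\<lambda>x. (cmod (f x))\<^sup>2 + (cmod (g x))\<^sup>2)"
    by (rule Bochner_Integration.integrable_add[OF assms[THEN L2_sq_int]])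
  show "(\<lambda>x. cnj (f x) * g x) \<in> borel_measurable P"
    by (intro borel_measurable_times borel_measurable_cnj_comp assms[THEN L2_meas])
  have "norm (cnj (f x) * g x) \<le> norm ((cmod (f x))\<^sup>2 + (cmod (g x))\<^sup>2)" for x
    using abs_mult_le_sum_squares[of "cmod (f x)" "cmod (g x)"] by (simp add: norm_mult)
  then show "AE x in P. norm (cnj (f x) * g x) \<le> norm ((cmod (f x))\<^sup>2 + (cmod (g x))\<^sup>2)"
    by (rule AE_I2)
qed

lemma L2_lincomb:
  assumes "f \<in> L2 P M" "g \<in> L2 P M"
  shows "(\<lambda>x. a * f x + b * g x) \<in> L2 P M"
proof -
  \<comment> \<open>Stated for any \<open>N\<close> because it is used twice: for \<open>P\<close>
    in the integrability proof and for the sigma-algebra generated by all of \<open>M\<close> in the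
    definition of \<open>L2\<close>.\<close>
  have meas: "(\<lambda>x. a * f x + b * g x) \<in> borel_measurable N"
    if "f \<in> borel_measurable N" "g \<in> borel_measurable N" for N :: "'a measure"
    using that by (intro borel_measurable_add borel_measurable_times) auto
  have "integrable P (\<lambda>x. (cmod (a * f x + b * g x))\<^sup>2)"
  proof (rule Bochner_Integration.integrable_bound)
    show "integrable P (\<lambda>x. 2 * (cmod a)\<^sup>2 * (cmod (f x))\<^sup>2 + 2 * (cmod b)\<^sup>2 * (cmod (g x))\<^sup>2)"
      by (intro Bochner_Integration.integrable_add integrable_mult_right assms[THEN L2_sq_int])
    show "(\<lambda>x. (cmod (a * f x + b * g x))\<^sup>2) \<in> borel_measurable P"
      by (rule borel_measurable_power[OF measurable_compose[OF meas[OF assms[THEN L2_meas]] borel_measurable_norm]])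
    have "norm ((cmod (a * f x + b * g x))\<^sup>2)
        \<le> norm (2 * (cmod a)\<^sup>2 * (cmod (f x))\<^sup>2 + 2 * (cmod b)\<^sup>2 * (cmod (g x))\<^sup>2)" for x
      using cmod_lincomb_sq_le[of a "f x" b "g x"] by simp
    then show "AE x in P. norm ((cmod (a * f x + b * g x))\<^sup>2)
        \<le> norm (2 * (cmod a)\<^sup>2 * (cmod (f x))\<^sup>2 + 2 * (cmod b)\<^sup>2 * (cmod (g x))\<^sup>2)"
      by (rule AE_I2)
  qed
  then show ?thesis using assms meas unfolding L2_def by blast
qed

lemma L2_inner_lincomb:
  assumes "h \<in> L2 P M" "f \<in> L2 P M" "g \<in> L2 P M"
  shows "L2_inner P h (\<lambda>x. a * f x + b * g x) = a * L2_inner P h f + b * L2_inner P h g"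
proof -
  have "L2_inner P h (\<lambda>x. a * f x + b * g x)
      = (\<integral>x. a * (cnj (h x) * f x) + b * (cnj (h x) * g x) \<partial>P)"
    unfolding L2_inner_def by (simp add: algebra_simps)
  also have "\<dots> = (\<integral>x. a * (cnj (h x) * f x) \<partial>P) + (\<integral>x. b * (cnj (h x) * g x) \<partial>P)"
    by (intro Bochner_Integration.integral_add integrable_mult_right L2_inner_integrable assms)
  finally show ?thesis unfolding L2_inner_def by simp
qed

text \<open>Conjugation commutes with the integral, also where the integrand is not integrable and
  both sides take the default value 0.\<close>

lemma L2_inner_commute: "L2_inner P g f = cnj (L2_inner P f g)"
proof -
  have "cnj (\<integral>x. cnj (f x) * g x \<partial>P) = (\<integral>x. cnj (cnj (f x) * g x) \<partial>P)"
    by (rule Bochner_Integration.integral_cnj[symmetric])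
  also have "\<dots> = (\<integral>x. cnj (g x) * f x \<partial>P)" by (simp add: mult.commute)
  finally show ?thesis unfolding L2_inner_def by (rule sym)
qed

lemma L2_sum:
  assumes "finite A" "\<And>i. i \<in> A \<Longrightarrow> f i \<in> L2 P M"
  shows "(\<lambda>x. \<Sum>i\<in>A. c i * f i x) \<in> L2 P M"
  using assms
proof (induction A rule: finite_induct)
  case empty
  then show ?case by (simp add: L2_def)
next
  case (insert i A)
  \<comment> \<open>The factor 1 brings the recursion into the shape of
    \<open>L2_lincomb\<close>.\<close>
  have "(\<lambda>x. \<Sum>j\<in>insert i A. c j * f j x) = (\<lambda>x. c i * f i x + 1 * (\<Sum>j\<in>A. c j * f j x))"
    using insert.hyps by simp
  moreover have "(\<lambda>x. c i * f i x + 1 * (\<Sum>j\<in>A. c j * f j x)) \<in> L2 P M"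
    by (rule L2_lincomb) (use insert in auto)
  ultimately show ?case by simp
qed

lemma L2_inner_sum:
  assumes "finite A" "\<And>i. i \<in> A \<Longrightarrow> f i \<in> L2 P M" "h \<in> L2 P M"
  shows "L2_inner P h (\<lambda>x. \<Sum>i\<in>A. c i * f i x) = (\<Sum>i\<in>A. c i * L2_inner P h (f i))"
  using assms(1,2)
proof (induction A rule: finite_induct)
  case empty
  then show ?case by (simp add: L2_inner_def)
next
  case (insert i A)
  have "(\<lambda>x. \<Sum>j\<in>insert i A. c j * f j x) = (\<lambda>x. c i * f i x + 1 * (\<Sum>j\<in>A. c j * f j x))"
    using insert.hyps by simp
  moreover have "L2_inner P h (\<lambda>x. c i * f i x + 1 * (\<Sum>j\<in>A. c j * f j x))
      = c i * L2_inner P h (f i) + 1 * L2_inner P h (\<lambda>x. \<Sum>j\<in>A. c j * f j x)"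
    by (rule L2_inner_lincomb[OF assms(3)]) (use insert in \<open>auto intro: L2_sum\<close>)
  ultimately show ?case using insert by simp
qed

lemma Re_L2_inner_self: "Re (L2_inner P f f) = (\<integral>x. (cmod (f x))\<^sup>2 \<partial>P)"
proof -
  have "L2_inner P f f = (\<integral>x. complex_of_real ((cmod (f x))\<^sup>2) \<partial>P)"
    unfolding L2_inner_def by (intro Bochner_Integration.integral_cong refl)
      (simp add: complex_norm_square mult.commute del: of_real_power)
  then show ?thesis by (simp only: integral_complex_of_real Re_complex_of_real)
qed

lemma L2_norm_nonneg: "L2_norm P f \<ge> 0"
  by (simp add: L2_norm_def Re_L2_inner_self)

lemma L2_norm_sq: "(L2_norm P f)\<^sup>2 = Re (L2_inner P f f)"
  by (simp add: L2_norm_def Re_L2_inner_self)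

text \<open>The defect \<open>\<parallel>\<xi> - (\<Sum>\<sigma>\<in>A. c \<sigma> * Z \<sigma>)\<parallel>\<^sup>2 - (\<parallel>\<xi>\<parallel>\<^sup>2 - (\<Sum>\<sigma>\<in>A. \<bar>\<langle>Z \<sigma>, \<xi>\<rangle>\<bar>\<^sup>2))\<close> is
  \<open>\<Sum>\<sigma>\<in>A. \<bar>c \<sigma> - \<langle>Z \<sigma>, \<xi>\<rangle>\<bar>\<^sup>2\<close>.\<close>

lemma L2_norm_le_coeffs:
  assumes \<xi>: "\<xi> \<in> L2 P M" and A: "finite A" "A \<subseteq> finsets"
  shows "(L2_norm P \<xi>)\<^sup>2 \<le> (\<Sum>\<sigma>\<in>A. (cmod (L2_inner P (Z M \<sigma>) \<xi>))\<^sup>2)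
    + (L2_norm P (\<lambda>x. \<xi> x - (\<Sum>\<sigma>\<in>A. c \<sigma> * Z M \<sigma> x)))\<^sup>2"
proof -
  define a where "a \<sigma> = L2_inner P (Z M \<sigma>) \<xi>" for \<sigma>
  define s where "s x = (\<Sum>\<sigma>\<in>A. c \<sigma> * Z M \<sigma> x)" for x
  have Z: "Z M \<sigma> \<in> L2 P M" if "\<sigma> \<in> A" for \<sigma> using that A by (auto intro: Z_L2)
  have s: "s \<in> L2 P M" unfolding s_def using A(1) Z by (rule L2_sum)
  have diff: "(\<lambda>x. \<xi> x - s x) = (\<lambda>x. 1 * \<xi> x + (-1) * s x)" by simp
  have d: "(\<lambda>x. \<xi> x - s x) \<in> L2 P M" unfolding diff by (intro L2_lincomb \<xi> s)
  have inner_diff: "L2_inner P h (\<lambda>x. \<xi> x - s x) = L2_inner P h \<xi> - L2_inner P h s"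
    if "h \<in> L2 P M" for h
    unfolding diff using L2_inner_lincomb[OF that \<xi> s, of 1 "-1"] by simp
  have Zs: "L2_inner P (Z M \<sigma>) s = c \<sigma>" if "\<sigma> \<in> A" for \<sigma>
  proof -
    have "L2_inner P (Z M \<sigma>) s = (\<Sum>\<tau>\<in>A. c \<tau> * L2_inner P (Z M \<sigma>) (Z M \<tau>))"
      unfolding s_def using A(1) Z Z[OF that] by (rule L2_inner_sum)
    also have "\<dots> = (\<Sum>\<tau>\<in>A. if \<tau> = \<sigma> then c \<tau> else 0)"
      using A(2) that by (intro sum.cong) (auto simp: Z_orthonormal subset_iff)
    finally show ?thesis using that A(1) by simp
  qed
  have inner_s: "L2_inner P h s = (\<Sum>\<sigma>\<in>A. c \<sigma> * cnj (L2_inner P (Z M \<sigma>) h))" if "h \<in> L2 P M" for h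
  proof -
    have "L2_inner P h s = (\<Sum>\<sigma>\<in>A. c \<sigma> * L2_inner P h (Z M \<sigma>))"
      unfolding s_def using A(1) Z that by (rule L2_inner_sum)
    then show ?thesis by (simp only: L2_inner_commute[of h])
  qed
  have "(L2_norm P (\<lambda>x. \<xi> x - s x))\<^sup>2 =
      Re (cnj (L2_inner P \<xi> \<xi> - L2_inner P \<xi> s) - (\<Sum>\<sigma>\<in>A. c \<sigma> * cnj (a \<sigma> - c \<sigma>)))"
  proof -
    have "L2_inner P (\<lambda>x. \<xi> x - s x) (\<lambda>x. \<xi> x - s x)
        = L2_inner P (\<lambda>x. \<xi> x - s x) \<xi> - L2_inner P (\<lambda>x. \<xi> x - s x) s"
      by (rule inner_diff[OF d])
    \<comment> \<open>Linearity is available in the second argument only, so the arguments are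
      swapped first.\<close>
    also have "L2_inner P (\<lambda>x. \<xi> x - s x) \<xi> = cnj (L2_inner P \<xi> \<xi> - L2_inner P \<xi> s)"
      by (subst L2_inner_commute) (simp add: inner_diff[OF \<xi>])
    also have "L2_inner P (\<lambda>x. \<xi> x - s x) s = (\<Sum>\<sigma>\<in>A. c \<sigma> * cnj (a \<sigma> - c \<sigma>))"
      using Zs by (subst inner_s[OF d]) (auto simp: inner_diff[OF Z] a_def intro!: sum.cong)
    finally show ?thesis by (simp only: L2_norm_sq)
  qed
  also have "\<dots> = (L2_norm P \<xi>)\<^sup>2 - (\<Sum>\<sigma>\<in>A. Re (c \<sigma> * cnj (a \<sigma>)) + Re (c \<sigma> * cnj (a \<sigma> - c \<sigma>)))"
    by (simp only: L2_norm_sq inner_s[OF \<xi>] a_def sum.distrib minus_complex.sel cnj.sel Re_sum)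
  \<comment> \<open>Completing the square: both sides of each summand equal 2 Re (c * cnj a) -
    |c|^2.\<close>
  also have "\<dots> = (L2_norm P \<xi>)\<^sup>2 - (\<Sum>\<sigma>\<in>A. (cmod (a \<sigma>))\<^sup>2 - (cmod (c \<sigma> - a \<sigma>))\<^sup>2)"
    by (intro arg_cong2[where f = minus] sum.cong refl)
      (simp only: cmod_power2, simp add: power2_eq_square algebra_simps)
  also have "\<dots> \<ge> (L2_norm P \<xi>)\<^sup>2 - (\<Sum>\<sigma>\<in>A. (cmod (a \<sigma>))\<^sup>2)"
    by (intro diff_left_mono sum_mono) simp
  finally show ?thesis unfolding a_def s_def by linarith
qed

section \<open>The test space S(M) and its norms\<close>

lemma S_space_L2: "\<xi> \<in> S_space P M \<Longrightarrow> \<xi> \<in> L2 P M"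
  by (auto simp: S_space_def S_level_def)

lemma S_space_summable: "\<xi> \<in> S_space P M \<Longrightarrow> S_summand P M p \<xi> summable_on finsets"
  by (auto simp: S_space_def S_level_def)

lemma S_summand_nonneg: "S_summand P M p \<xi> \<sigma> \<ge> 0"
  by (auto simp: S_summand_def weight_def intro!: mult_nonneg_nonneg zero_le_power prod_nonneg)

lemma S_space_lincomb:
  assumes "\<xi> \<in> S_space P M" "\<eta> \<in> S_space P M"
  shows "(\<lambda>x. a * \<xi> x + b * \<eta> x) \<in> S_space P M"
proof -
  note L2 = assms[THEN S_space_L2]
  have "S_summand P M p (\<lambda>x. a * \<xi> x + b * \<eta> x) summable_on finsets" for p
  proof (rule summable_on_comparison_test)
    show "(\<lambda>\<sigma>. 2 * (cmod a)\<^sup>2 * S_summand P M p \<xi> \<sigma> + 2 * (cmod b)\<^sup>2 * S_summand P M p \<eta> \<sigma>)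
        summable_on finsets"
      by (intro summable_on_add summable_on_cmult_right S_space_summable assms)
    fix \<sigma> assume "\<sigma> \<in> (finsets :: nat set set)"
    then have inner: "L2_inner P (Z M \<sigma>) (\<lambda>x. a * \<xi> x + b * \<eta> x)
        = a * L2_inner P (Z M \<sigma>) \<xi> + b * L2_inner P (Z M \<sigma>) \<eta>"
      by (intro L2_inner_lincomb L2 Z_L2)
    have "0 \<le> weight \<sigma> ^ (2 * p)"
      by (auto simp: weight_def intro!: zero_le_power prod_nonneg)
    from mult_left_mono[OF cmod_lincomb_sq_le[of a "L2_inner P (Z M \<sigma>) \<xi>" b "L2_inner P (Z M \<sigma>) \<eta>"] this]
    show "S_summand P M p (\<lambda>x. a * \<xi> x + b * \<eta> x) \<sigma>
        \<le> 2 * (cmod a)\<^sup>2 * S_summand P M p \<xi> \<sigma> + 2 * (cmod b)\<^sup>2 * S_summand P M p \<eta> \<sigma>"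
      unfolding S_summand_def inner by (simp add: algebra_simps)
  qed (rule S_summand_nonneg)
  then show ?thesis using L2_lincomb[OF L2] by (auto simp: S_space_def S_level_def)
qed

text \<open>By orthonormality the series of every level \<open>p\<close> has at most one nonzero
  term, the one at \<sigma>.\<close>

lemma Z_S_space:
  assumes "\<sigma> \<in> finsets"
  shows "Z M \<sigma> \<in> S_space P M"
proof -
  have "S_summand P M p (Z M \<sigma>) summable_on finsets" for p
    by (rule finite_nonzero_values_imp_summable_on, rule finite_subset[of _ "{\<sigma>}"])
      (auto simp: S_summand_def Z_orthonormal assms split: if_splits)
  then show ?thesis using Z_L2[OF assms] by (auto simp: S_space_def S_level_def)
qed

text \<open>The half of Parseval's identity that rests on totality. A finite combination close to
  \<xi> bounds its norm by finitely many coefficients plus a small error, whatever the coefficients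
  \<open>c\<close> are; at level 0 the weights are 1, so the full series dominates that finite
  sum.\<close>

lemma L2_norm_le_S_norm:
  assumes chaotic: "chaotic_representation P M" and \<xi>: "\<xi> \<in> S_space P M"
  shows "(L2_norm P \<xi>)\<^sup>2 \<le> (S_norm P M 0 \<xi>)\<^sup>2"
proof (rule field_le_epsilon)
  fix e :: real assume "e > 0"
  note L2 = S_space_L2[OF \<xi>]
  \<comment> \<open>The tolerance is \<open>sqrt e\<close> because the error enters squared.\<close>
  obtain A c where A: "finite A" "A \<subseteq> finsets"
    and less: "L2_norm P (\<lambda>x. \<xi> x - (\<Sum>\<sigma>\<in>A. c \<sigma> * Z M \<sigma> x)) < sqrt e"
    using chaotic L2 \<open>e > 0\<close> unfolding chaotic_representation_def by (meson real_sqrt_gt_zero)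
  have "(L2_norm P (\<lambda>x. \<xi> x - (\<Sum>\<sigma>\<in>A. c \<sigma> * Z M \<sigma> x)))\<^sup>2 \<le> (sqrt e)\<^sup>2"
    using less L2_norm_nonneg by (intro power_mono) auto
  also have "\<dots> = e" using \<open>e > 0\<close> by simp
  finally have small: "(L2_norm P (\<lambda>x. \<xi> x - (\<Sum>\<sigma>\<in>A. c \<sigma> * Z M \<sigma> x)))\<^sup>2 \<le> e" .
  have "(\<Sum>\<sigma>\<in>A. S_summand P M 0 \<xi> \<sigma>) \<le> (\<Sum>\<^sub>\<infinity>\<sigma>\<in>finsets. S_summand P M 0 \<xi> \<sigma>)"
    by (rule finite_sum_le_infsum[OF S_space_summable[OF \<xi>] A S_summand_nonneg])
  also have "\<dots> = (S_norm P M 0 \<xi>)\<^sup>2"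
    by (simp add: S_norm_def infsum_nonneg S_summand_nonneg)
  finally have "(\<Sum>\<sigma>\<in>A. (cmod (L2_inner P (Z M \<sigma>) \<xi>))\<^sup>2) \<le> (S_norm P M 0 \<xi>)\<^sup>2"
    by (simp add: S_summand_def)
  then show "(L2_norm P \<xi>)\<^sup>2 \<le> (S_norm P M 0 \<xi>)\<^sup>2 + e"
    using L2_norm_le_coeffs[OF L2 A, of c] small by linarith
qed

section \<open>Continuity of the functionals induced by L2(M)\<close>

text \<open>A substitute for the Cauchy-Schwarz inequality with a free parameter: \<open>t\<close>
  can be taken small against the fixed \<open>f\<close>, after which \<open>g\<close> is made small
  against \<open>t\<close>.\<close>

lemma L2_inner_bound:
  assumes f: "f \<in> L2 P M" and g: "g \<in> L2 P M" and "t > 0"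
  shows "cmod (L2_inner P f g) \<le> t * (L2_norm P f)\<^sup>2 + (L2_norm P g)\<^sup>2 / t"
proof -
  have "norm (\<integral>x. cnj (f x) * g x \<partial>P) \<le> (\<integral>x. norm (cnj (f x) * g x) \<partial>P)"
    by (rule integral_norm_bound)
  also have "\<dots> \<le> (\<integral>x. t * (cmod (f x))\<^sup>2 + (cmod (g x))\<^sup>2 / t \<partial>P)"
  proof (rule integral_mono)
    show "integrable P (\<lambda>x. t * (cmod (f x))\<^sup>2 + (cmod (g x))\<^sup>2 / t)"
      by (intro Bochner_Integration.integrable_add integrable_mult_right integrable_divide
          f[THEN L2_sq_int] g[THEN L2_sq_int])
    fix x
    \<comment> \<open>Rescaling the factors by \<open>sqrt t\<close> and its inverse keeps the
      product and shifts the weight between the squares.\<close>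
    have "\<bar>(sqrt t * cmod (f x)) * (cmod (g x) / sqrt t)\<bar>
        \<le> (sqrt t * cmod (f x))\<^sup>2 + (cmod (g x) / sqrt t)\<^sup>2"
      by (rule abs_mult_le_sum_squares)
    then show "norm (cnj (f x) * g x) \<le> t * (cmod (f x))\<^sup>2 + (cmod (g x))\<^sup>2 / t"
      using \<open>t > 0\<close> by (simp add: norm_mult power_mult_distrib power_divide)
  qed (rule integrable_norm[OF L2_inner_integrable[OF f g]])
  also have "\<dots> = t * (\<integral>x. (cmod (f x))\<^sup>2 \<partial>P) + (\<integral>x. (cmod (g x))\<^sup>2 \<partial>P) / t"
    by (subst Bochner_Integration.integral_add)
      (auto intro: integrable_mult_right integrable_divide f[THEN L2_sq_int] g[THEN L2_sq_int])
  finally show ?thesis by (simp add: L2_inner_def[symmetric] L2_norm_sq Re_L2_inner_self)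
qed

lemma topspace_S_topology: "topspace (S_topology P M) = S_space P M"
proof -
  \<comment> \<open>Every point is the centre of a generating ball, since the zero function has norm
    0; level 0 and radius 1 are an arbitrary choice.\<close>
  have "\<xi> \<in> {\<eta> \<in> S_space P M. S_norm P M 0 (\<lambda>x. \<eta> x - \<xi> x) < 1}" if "\<xi> \<in> S_space P M" for \<xi>
    using that by (simp add: S_norm_def S_summand_def L2_inner_def)
  then have "S_space P M \<subseteq> topspace (S_topology P M)"
    unfolding S_topology_def topology_generated_by_topspace using zero_less_one by blast
  moreover have "topspace (S_topology P M) \<subseteq> S_space P M"
    unfolding S_topology_def topology_generated_by_topspace by blast
  ultimately show ?thesis by blast
qed

lemma openin_S_ball:
  assumes "\<xi> \<in> S_space P M" "r > 0"
  shows "openin (S_topology P M) {\<eta> \<in> S_space P M. S_norm P M p (\<lambda>x. \<eta> x - \<xi> x) < r}"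
  unfolding S_topology_def using assms by (intro topology_generated_by_Basis) auto

text \<open>For continuity at a point a single ball of level 0 suffices, because that norm already
  dominates the L2 norm. The error \<open>e\<close> is split evenly between the two terms of
  \<open>L2_inner_bound\<close>.\<close>

lemma L2_embed_S_dual:
  assumes chaotic: "chaotic_representation P M" and \<xi>: "\<xi> \<in> L2 P M"
  shows "L2_embed P M \<xi> \<in> S_dual P M"
proof -
  have "L2_embed P M \<xi> (\<lambda>x. a * \<zeta> x + b * \<eta> x) = a * L2_embed P M \<xi> \<zeta> + b * L2_embed P M \<xi> \<eta>"
    if "\<zeta> \<in> S_space P M" "\<eta> \<in> S_space P M" for \<zeta> \<eta> a b
    using that S_space_lincomb[OF that] L2_inner_lincomb[OF \<xi> that[THEN S_space_L2]]
    by (simp add: L2_embed_def)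
  moreover have "continuous_map (S_topology P M) euclidean (L2_embed P M \<xi>)"
    unfolding continuous_map_eq_topcontinuous_at topcontinuous_at_def topspace_S_topology
  proof (intro ballI conjI allI impI)
    fix \<eta> V assume \<eta>: "\<eta> \<in> S_space P M"
      and "openin euclidean V \<and> L2_embed P M \<xi> \<eta> \<in> V"
    then obtain e where e: "e > 0" "ball (L2_embed P M \<xi> \<eta>) e \<subseteq> V"
      by (auto elim: openE)
    \<comment> \<open>The summand 1 keeps the denominator positive when \<xi> has norm 0 and makes
      the bound by \<open>e / 2\<close> strict.\<close>
    define t where "t = e / (2 * ((L2_norm P \<xi>)\<^sup>2 + 1))"
    have "(L2_norm P \<xi>)\<^sup>2 + 1 > 0" by (intro add_nonneg_pos) auto
    then have t: "t > 0" "t * (L2_norm P \<xi>)\<^sup>2 < e / 2"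
      using e(1) by (auto simp: t_def field_simps)
    \<comment> \<open>Chosen so that r^2 / t = e / 2.\<close>
    define r where "r = sqrt (t * e / 2)"
    have r: "r > 0" "r\<^sup>2 = t * e / 2" using t(1) e(1) by (auto simp: r_def)
    let ?U = "{\<zeta> \<in> S_space P M. S_norm P M 0 (\<lambda>x. \<zeta> x - \<eta> x) < r}"
    have "L2_embed P M \<xi> \<zeta> \<in> V" if \<zeta>: "\<zeta> \<in> ?U" for \<zeta>
    proof -
      define d where "d x = 1 * \<zeta> x + (-1) * \<eta> x" for x
      have d: "d \<in> S_space P M" unfolding d_def using \<zeta> \<eta> by (intro S_space_lincomb) auto
      have "S_norm P M 0 d < r" using \<zeta> by (simp add: d_def[abs_def])
      moreover have "0 \<le> S_norm P M 0 d"
        by (simp add: S_norm_def infsum_nonneg S_summand_nonneg)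
      ultimately have "(S_norm P M 0 d)\<^sup>2 \<le> r\<^sup>2" by (intro power_mono) auto
      then have "(L2_norm P d)\<^sup>2 \<le> t * e / 2"
        using L2_norm_le_S_norm[OF chaotic d] r(2) by linarith
      then have "(L2_norm P d)\<^sup>2 / t \<le> e / 2" using t(1) by (simp add: field_simps)
      then have "cmod (L2_inner P \<xi> d) < e"
        using L2_inner_bound[OF \<xi> S_space_L2[OF d] t(1)] t(2) by linarith
      moreover have "L2_inner P \<xi> d = L2_inner P \<xi> \<zeta> - L2_inner P \<xi> \<eta>"
        unfolding d_def using \<zeta> \<eta> \<xi> by (subst L2_inner_lincomb) (auto intro: S_space_L2)
      ultimately have "L2_embed P M \<xi> \<zeta> \<in> ball (L2_embed P M \<xi> \<eta>) e"
        using \<zeta> \<eta> by (simp add: L2_embed_def dist_norm norm_minus_commute)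
      then show ?thesis using e(2) by blast
    qed
    moreover have "\<eta> \<in> ?U" using \<eta> r(1) by (simp add: S_norm_def S_summand_def L2_inner_def)
    moreover have "openin (S_topology P M) ?U" using \<eta> r(1) by (rule openin_S_ball)
    ultimately show "\<exists>U. openin (S_topology P M) U \<and> \<eta> \<in> U \<and> (\<forall>\<zeta>\<in>U. L2_embed P M \<xi> \<zeta> \<in> V)"
      by blast
  qed auto
  ultimately show ?thesis by (auto simp: S_dual_def L2_embed_def)
qed

section \<open>Fock coefficients of a martingale\<close>

lemma fock_L2_embed:
  assumes "\<sigma> \<in> finsets"
  shows "fock M (L2_embed P M \<xi>) \<sigma> = L2_inner P \<xi> (Z M \<sigma>)"
  using Z_S_space[OF assms] by (simp add: fock_def L2_embed_def)

lemma L2_inner_Z_eq_0: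
  assumes \<xi>: "\<xi> \<in> L2 P M" and \<sigma>: "\<sigma> \<in> finsets" "\<not> \<sigma> \<subseteq> {0..n}"
    and g: "g \<in> borel_measurable (gen_sigma P (noise M) {..n})" "AE x in P. \<xi> x = g x"
  shows "L2_inner P \<xi> (Z M \<sigma>) = 0"
proof -
  have fin: "finite \<sigma>" using \<sigma>(1) by (simp add: finsets_def)
  define m where "m = Max \<sigma>"
  obtain i where "i \<in> \<sigma>" "n < i" using \<sigma>(2) by force
  have max: "k \<le> m" if "k \<in> \<sigma>" for k unfolding m_def using fin that by (rule Max_ge)
  have m: "m \<in> \<sigma>" unfolding m_def using fin \<open>i \<in> \<sigma>\<close> by (intro Max_in) auto
  have "n < m" using max[OF \<open>i \<in> \<sigma>\<close>] \<open>n < i\<close> by simp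
  have sub: "\<sigma> - {m} \<subseteq> {..<m}" using max by (auto simp: order_less_le)
  have Z: "Z M \<sigma> x = Z M (\<sigma> - {m}) x * complex_of_real (noise M m x)" for x
    using fin m by (simp add: Z_def prod.remove[of \<sigma> m] mult.commute)
  have Z_meas: "Z M (\<sigma> - {m}) \<in> borel_measurable (past m)"
    unfolding Z_def[abs_def] by (rule measurable_compose[OF prod_noise_meas[OF sub]]) simp
  \<comment> \<open>The filtration is generated by the noise and \<open>past m\<close> by
    \<open>M\<close>; for k \<le> n < m the k-th noise is a function of M_0, ..., M_{m-1}.\<close>
  have g_past: "g \<in> borel_measurable (past m)"
    using g(1) by (rule borel_measurable_gen_sigma_mono) (use \<open>n < m\<close> in \<open>auto intro!: noise_meas_gen_sigma\<close>)
  have X_meas: "(\<lambda>x. cnj (g x) * Z M (\<sigma> - {m}) x) \<in> borel_measurable (past m)"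
    by (intro borel_measurable_times borel_measurable_cnj_comp g_past Z_meas)
  have g_meas: "g \<in> borel_measurable P"
    using g_past by (rule borel_measurable_gen_sigma_mono) auto
  \<comment> \<open>Only the version \<open>g\<close> of \<xi> is known to be measurable with
    respect to the past, so it replaces \<xi> before the top noise is split off.\<close>
  have ae: "AE x in P. cnj (\<xi> x) * Z M \<sigma> x = (cnj (g x) * Z M (\<sigma> - {m}) x) * complex_of_real (noise M m x)"
    using g(2) by eventually_elim (simp add: Z mult.assoc)
  have meas: "(\<lambda>x. (cnj (g x) * Z M (\<sigma> - {m}) x) * complex_of_real (noise M m x)) \<in> borel_measurable P"
    unfolding mult.assoc Z[symmetric]
    by (intro borel_measurable_times borel_measurable_cnj_comp g_meas L2_meas Z_L2 \<sigma>(1))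
  note int = L2_inner_integrable[OF \<xi> Z_L2[OF \<sigma>(1)]]
  have "L2_inner P \<xi> (Z M \<sigma>) =
      (\<integral>x. (cnj (g x) * Z M (\<sigma> - {m}) x) * complex_of_real (noise M m x) \<partial>P)"
    unfolding L2_inner_def by (rule integral_cong_AE[OF borel_measurable_integrable[OF int] meas ae])
  also have "\<dots> = 0"
    using integrable_cong_AE_imp[OF int meas ae] by (rule noise_orthogonal_past_complex[OF X_meas])
  finally show ?thesis .
qed

text \<open>As \<open>h\<close> is real, the real and imaginary parts of the inner products involve
  only the corresponding parts of the functions. Each of them is the averaging property of a real
  conditional expectation, tested against \<open>h\<close>.\<close>

lemma L2_inner_cond_exp:
  fixes h :: "'a \<Rightarrow> real"
  assumes F: "finite_measure_subalgebra P F" and \<xi>: "integrable P \<xi>" "integrable P \<zeta>"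
    and ce: "AE x in P. complex_cond_exp P F \<zeta> x = \<xi> x"
    and h: "h \<in> borel_measurable F"
    and int: "integrable P (\<lambda>x. cnj (\<xi> x) * complex_of_real (h x))"
      "integrable P (\<lambda>x. cnj (\<zeta> x) * complex_of_real (h x))"
  shows "L2_inner P \<xi> (\<lambda>x. complex_of_real (h x)) = L2_inner P \<zeta> (\<lambda>x. complex_of_real (h x))"
proof -
  interpret F: finite_measure_subalgebra P F by (rule F)
  have [measurable]: "\<xi> \<in> borel_measurable P" "\<zeta> \<in> borel_measurable P" "h \<in> borel_measurable P"
    using \<xi> measurable_from_subalg[OF F.subalg h] by auto
  \<comment> \<open>Conjugation flips the sign of the imaginary part, hence the
    \<open>integrable_minus\<close>.\<close>
  have re: "integrable P (\<lambda>x. h x * Re (\<zeta> x))" and im: "integrable P (\<lambda>x. h x * Im (\<zeta> x))"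
    using integrable_Re[OF int(2)] integrable_minus[OF integrable_Im[OF int(2)]]
    by (simp_all add: mult.commute)
  have ceRe: "AE x in P. h x * Re (\<xi> x) = h x * real_cond_exp P F (\<lambda>y. Re (\<zeta> y)) x"
    and ceIm: "AE x in P. h x * Im (\<xi> x) = h x * real_cond_exp P F (\<lambda>y. Im (\<zeta> y)) x"
    using ce by (eventually_elim, simp add: complex_cond_exp_def complex_eq_iff)+
  note ce_meas = measurable_from_subalg[OF F.subalg borel_measurable_cond_exp]
  have "(\<integral>x. h x * Re (\<xi> x) \<partial>P) = (\<integral>x. h x * real_cond_exp P F (\<lambda>y. Re (\<zeta> y)) x \<partial>P)"
    using ceRe by (intro integral_cong_AE borel_measurable_times ce_meas) auto
  also have "\<dots> = (\<integral>x. h x * Re (\<zeta> x) \<partial>P)"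
    by (rule F.real_cond_exp_intg(2)[OF re h]) simp
  finally have Re: "(\<integral>x. h x * Re (\<xi> x) \<partial>P) = (\<integral>x. h x * Re (\<zeta> x) \<partial>P)" .
  have "(\<integral>x. h x * Im (\<xi> x) \<partial>P) = (\<integral>x. h x * real_cond_exp P F (\<lambda>y. Im (\<zeta> y)) x \<partial>P)"
    using ceIm by (intro integral_cong_AE borel_measurable_times ce_meas) auto
  also have "\<dots> = (\<integral>x. h x * Im (\<zeta> x) \<partial>P)"
    by (rule F.real_cond_exp_intg(2)[OF im h]) simp
  finally have Im: "(\<integral>x. h x * Im (\<xi> x) \<partial>P) = (\<integral>x. h x * Im (\<zeta> x) \<partial>P)" .
  show ?thesis
    unfolding L2_inner_def
    using Re Im integral_Re[OF int(1)] integral_Re[OF int(2)] integral_Im[OF int(1)] integral_Im[OF int(2)]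
    by (intro complex_eqI) (simp_all add: mult.commute)
qed

end

theorem theorem4p1:
  fixes P :: "'a measure" and M :: "nat \<Rightarrow> 'a \<Rightarrow> real" and \<xi> :: "nat \<Rightarrow> 'a \<Rightarrow> complex"
  assumes "prob_space P"
    and "normal_martingale P M"
    and "chaotic_representation P M"
    and "\<And>n. \<xi> n \<in> L2 P M"
    and "martingale P (\<lambda>n. gen_sigma P (noise M) {..n}) \<xi>"
  shows "generalized_martingale P M (\<lambda>n. L2_embed P M (\<xi> n))"
proof -
  interpret normal_martingale_space P M
    by (intro normal_martingale_space.intro normal_martingale_space_axioms.intro assms)
  note mart = assms(5)[unfolded martingale_def, THEN conjunct1, rule_format]
    assms(5)[unfolded martingale_def, THEN conjunct2, THEN conjunct1, rule_format]
    assms(5)[unfolded martingale_def, THEN conjunct2, THEN conjunct2, rule_format]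
  have inner: "L2_inner P (\<xi> n) (Z M \<sigma>) = indicator (Pow {0..n}) \<sigma> * L2_inner P (\<xi> (Suc n)) (Z M \<sigma>)"
    if \<sigma>: "\<sigma> \<in> finsets" for n \<sigma>
  proof (cases "\<sigma> \<subseteq> {0..n}")
    case True
    have "L2_inner P (\<xi> n) (Z M \<sigma>) = L2_inner P (\<xi> (Suc n)) (Z M \<sigma>)"
      \<comment> \<open>Exposes \<open>Z\<close> as a real product, the \<open>h\<close> of
        \<open>L2_inner_cond_exp\<close>; all its factors have index at most
        \<open>n\<close>.\<close>
      unfolding Z_def[abs_def]
    proof (rule L2_inner_cond_exp)
      show "finite_measure_subalgebra P (gen_sigma P (noise M) {..n})"
        by (rule finite_measure_subalgebra_gen_sigma) simp
      show "(\<lambda>x. \<Prod>i\<in>\<sigma>. noise M i x) \<in> borel_measurable (gen_sigma P (noise M) {..n})"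
        using True by (intro borel_measurable_prod measurable_gen_sigma) auto
      have "integrable P (\<lambda>x. cnj (\<xi> k x) * complex_of_real (\<Prod>i\<in>\<sigma>. noise M i x))" for k
        using L2_inner_integrable[OF assms(4) Z_L2[OF \<sigma>], of k] by (simp add: Z_def)
      from this[of n] this[of "Suc n"]
      show "integrable P (\<lambda>x. cnj (\<xi> n x) * complex_of_real (\<Prod>i\<in>\<sigma>. noise M i x))"
        "integrable P (\<lambda>x. cnj (\<xi> (Suc n) x) * complex_of_real (\<Prod>i\<in>\<sigma>. noise M i x))" .
    qed (rule mart)+
    then show ?thesis using True by simp
  next
    case False
    \<comment> \<open>The indicator is 0 here, so the coefficient at \<open>n\<close> must vanish;
      adaptedness supplies the version of \<xi> for this.\<close>
    obtain g where "g \<in> borel_measurable (gen_sigma P (noise M) {..n})" "AE x in P. \<xi> n x = g x"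
      using mart(2)[of n] by blast
    then have "L2_inner P (\<xi> n) (Z M \<sigma>) = 0" by (rule L2_inner_Z_eq_0[OF assms(4) \<sigma> False])
    then show ?thesis using False by simp
  qed
  have "fock M (L2_embed P M (\<xi> n)) \<sigma>
      = indicator (Pow {0..n}) \<sigma> * fock M (L2_embed P M (\<xi> (Suc n))) \<sigma>"
    if "\<sigma> \<in> finsets" for n \<sigma>
    unfolding fock_L2_embed[OF that] using that by (rule inner)
  then show ?thesis
    unfolding generalized_martingale_def using L2_embed_S_dual[OF assms(3,4)] by blast
qed

end
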